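(* Let $(\Omega,\rho)$ be a Euclidean polynomial space of dimension $n$, and let $X\subset\Omega$ be a weighted $t$-design with weight function $w$. Suppose there exists an injection $\tau:\Omega\to\mathbb{R}^n$ that is affinely compatible with $\rho$. Then \[ \langle 1,f\circ\tau\rangle=\sum_{x\in X}w(x)\,f(\tau(x))\quad\text{for all } f\in\mathbb{R}_t[x_1,\ldots,x_n]. \] In particular, if $\Omega$ is finite with probability function $\mu$ (and inner product $\langle g,h\rangle=\sum_{x\in\Omega}g(x)h(x)\mu(x)$), then \[ \sum_{x\in\Omega}f(\tau(x))\mu(x)=\sum_{x\in X}w(x)f(\tau(x)),\qquad\text{equivalently}\qquad\sum_{y\in\tau(\Omega)}f(y)\mu(\tau^{-1}(y))=\sum_{y\in\tau(X)}w(\tau^{-1}(y))f(y), \] for all $f\in\mathbb{R}_t[x_1,\ldots,x_n]$.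
   Context: Let $\Omega$ be a nonempty set and $\rho:\Omega\times\Omega\to\mathbb{R}$ a function (the separation function); for $a\in\Omega$ write $\rho_a(\eta)=\rho(a,\eta)$. Let $\mathrm{Pol}(\Omega,0)$ be the space of constant real functions on $\Omega$, $\mathrm{Pol}(\Omega,1)=\mathrm{Span}_{\mathbb{R}}\{f\circ\rho_a : a\in\Omega,\ f\in\mathbb{R}[x],\ \deg f\le 1\}$, and inductively $\mathrm{Pol}(\Omega,r+1)=\mathrm{Span}_{\mathbb{R}}\{gh : g\in\mathrm{Pol}(\Omega,r),\ h\in\mathrm{Pol}(\Omega,1)\}$; $\mathrm{Pol}(\Omega)=\bigcup_r\mathrm{Pol}(\Omega,r)$. $(\Omega,\rho)$ with an inner product $\langle\cdot,\cdot\rangle$ on $\mathrm{Pol}(\Omega)$ is a polynomial space if: (i) $\rho$ is symmetric; (ii) each $\mathrm{Pol}(\Omega,r)$ is finite-dimensional; (iii) $\langle f,g\rangle=\langle 1,fg\rangle$; (iv) if $f\ge0$ pointwise then $\langle1,f\rangle\ge0$, with equality iff $f=0$; normalized so $\langle1,1\rangle=1$. Its dimension is $\dim\mathrm{Pol}(\Omega,1)-1$. Separation functions $\rho,\sigma$ are affinely equivalent if $\rho=a\sigma+b$ with $a\ne0$. The polynomial space is Euclidean if there are an injection $\tau_0:\Omega\to\mathbb{R}^d$ (some $d$) and $\rho'$ affinely equivalent to $\rho$ with $\rho'(x,y)=(\tau_0(x),\tau_0(y))$ (standard inner product). An injection $\tau:\Omega\to\mathbb{R}^m$ is affinely compatible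 with $\rho$ if $\rho(x,y)=a(\tau(x),\tau(y))+b$ for some $a\ne0$, $b$ and all $x,y$. A weighted $t$-design is a finite $X\subset\Omega$ with $w:X\to\mathbb{R}_{>0}$ such that $\langle1,f\rangle=\sum_{x\in X}w(x)f(x)$ for all $f\in\mathrm{Pol}(\Omega,t)$. A probability function on finite $\Omega$ is $\mu:\Omega\to\mathbb{R}_{\ge0}$ with $\sum_x\mu(x)=1$. $\mathbb{R}_t[x_1,\ldots,x_n]$ is the space of real polynomials of total degree at most $t$. *)

theory Defs
  imports
    Complex_Main
    "HOL-Library.Function_Algebras"
    "HOL-Library.Poly_Mapping"
    "HOL-Computational_Algebra.Polynomial"
    "Jordan_Normal_Form.Matrix"
begin

section \<open>Real functions on a carrier\<close>

text \<open>
  A real function on a set \<open>\<Omega>\<close> is represented by the function on the whole type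
  that agrees with it on \<open>\<Omega>\<close> and vanishes outside; pointwise sums and products
  (from \<open>Function_Algebras\<close>) and scalar multiples preserve this form, and equality of such
  functions is equality on \<open>\<Omega>\<close>.
\<close>

definition fun_on :: "'a set \<Rightarrow> ('a \<Rightarrow> real) \<Rightarrow> 'a \<Rightarrow> real" where
  "fun_on \<Omega> f = (\<lambda>x. if x \<in> \<Omega> then f x else 0)"

definition fscale :: "real \<Rightarrow> ('a \<Rightarrow> real) \<Rightarrow> 'a \<Rightarrow> real" where
  "fscale c f = (\<lambda>x. c * f x)"

global_interpretation fspace: vector_space "fscale :: real \<Rightarrow> ('a \<Rightarrow> real) \<Rightarrow> 'a \<Rightarrow> real"
  by unfold_locales (auto simp: fscale_def algebra_simps)

section \<open>Polynomial spaces\<close>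

fun Pol_deg :: "'a set \<Rightarrow> ('a \<Rightarrow> 'a \<Rightarrow> real) \<Rightarrow> nat \<Rightarrow> ('a \<Rightarrow> real) set" where
  "Pol_deg \<Omega> \<rho> 0 = {fun_on \<Omega> (\<lambda>_. c) | c. True}"
| "Pol_deg \<Omega> \<rho> (Suc 0) =
     fspace.span {fun_on \<Omega> (poly f \<circ> \<rho> a) | a f. a \<in> \<Omega> \<and> degree f \<le> 1}"
| "Pol_deg \<Omega> \<rho> (Suc (Suc r)) =
     fspace.span {g * h | g h. g \<in> Pol_deg \<Omega> \<rho> (Suc r) \<and> h \<in> Pol_deg \<Omega> \<rho> (Suc 0)}"

definition Pol :: "'a set \<Rightarrow> ('a \<Rightarrow> 'a \<Rightarrow> real) \<Rightarrow> ('a \<Rightarrow> real) set" where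
  "Pol \<Omega> \<rho> = (\<Union>r. Pol_deg \<Omega> \<rho> r)"

definition inner_product_on ::
    "('a \<Rightarrow> real) set \<Rightarrow> (('a \<Rightarrow> real) \<Rightarrow> ('a \<Rightarrow> real) \<Rightarrow> real) \<Rightarrow> bool" where
  "inner_product_on V ip \<longleftrightarrow>
     (\<forall>f\<in>V. \<forall>g\<in>V. ip f g = ip g f) \<and>
     (\<forall>f\<in>V. \<forall>g\<in>V. \<forall>h\<in>V. ip (f + g) h = ip f h + ip g h) \<and>
     (\<forall>c. \<forall>f\<in>V. \<forall>g\<in>V. ip (fscale c f) g = c * ip f g) \<and>
     (\<forall>f\<in>V. f \<noteq> 0 \<longrightarrow> ip f f > 0)"

locale polynomial_space =
  fixes \<Omega> :: "'a set"
    and \<rho> :: "'a \<Rightarrow> 'a \<Rightarrow> real"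
    and ip :: "('a \<Rightarrow> real) \<Rightarrow> ('a \<Rightarrow> real) \<Rightarrow> real"
  assumes nonempty: "\<Omega> \<noteq> {}"
    and inner_product: "inner_product_on (Pol \<Omega> \<rho>) ip"
    and separation_sym: "x \<in> \<Omega> \<Longrightarrow> y \<in> \<Omega> \<Longrightarrow> \<rho> x y = \<rho> y x"
    and finite_dimensional: "\<exists>B. finite B \<and> fspace.span B = Pol_deg \<Omega> \<rho> r"
    and ip_mult: "f \<in> Pol \<Omega> \<rho> \<Longrightarrow> g \<in> Pol \<Omega> \<rho> \<Longrightarrow> ip f g = ip (fun_on \<Omega> (\<lambda>_. 1)) (f * g)"
    and ip_nonneg: "f \<in> Pol \<Omega> \<rho> \<Longrightarrow> (\<And>x. x \<in> \<Omega> \<Longrightarrow> f x \<ge> 0) \<Longrightarrow> ip (fun_on \<Omega> (\<lambda>_. 1)) f \<ge> 0"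
    and ip_eq_0_iff: "f \<in> Pol \<Omega> \<rho> \<Longrightarrow> (\<And>x. x \<in> \<Omega> \<Longrightarrow> f x \<ge> 0) \<Longrightarrow>
           ip (fun_on \<Omega> (\<lambda>_. 1)) f = 0 \<longleftrightarrow> f = 0"
    and ip_normalized: "ip (fun_on \<Omega> (\<lambda>_. 1)) (fun_on \<Omega> (\<lambda>_. 1)) = 1"

text \<open>
  The truncated subtraction is harmless: for nonempty \<open>\<Omega>\<close> the constants lie in
  \<open>Pol_deg \<Omega> \<rho> 1\<close>, so its dimension is positive whenever it is finite.
\<close>

definition Pol_dim :: "'a set \<Rightarrow> ('a \<Rightarrow> 'a \<Rightarrow> real) \<Rightarrow> nat" where
  "Pol_dim \<Omega> \<rho> = fspace.dim (Pol_deg \<Omega> \<rho> 1) - 1"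

definition affinely_equivalent ::
    "'a set \<Rightarrow> ('a \<Rightarrow> 'a \<Rightarrow> real) \<Rightarrow> ('a \<Rightarrow> 'a \<Rightarrow> real) \<Rightarrow> bool" where
  "affinely_equivalent \<Omega> \<rho> \<sigma> \<longleftrightarrow>
     (\<exists>a b. a \<noteq> 0 \<and> (\<forall>x\<in>\<Omega>. \<forall>y\<in>\<Omega>. \<rho> x y = a * \<sigma> x y + b))"

definition euclidean :: "'a set \<Rightarrow> ('a \<Rightarrow> 'a \<Rightarrow> real) \<Rightarrow> bool" where
  "euclidean \<Omega> \<rho> \<longleftrightarrow>
     (\<exists>d \<tau>\<^sub>0 \<rho>'. \<tau>\<^sub>0 \<in> \<Omega> \<rightarrow> carrier_vec d \<and> inj_on \<tau>\<^sub>0 \<Omega> \<and> affinely_equivalent \<Omega> \<rho>' \<rho> \<and>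
        (\<forall>x\<in>\<Omega>. \<forall>y\<in>\<Omega>. \<rho>' x y = \<tau>\<^sub>0 x \<bullet> \<tau>\<^sub>0 y))"

definition affinely_compatible ::
    "'a set \<Rightarrow> ('a \<Rightarrow> 'a \<Rightarrow> real) \<Rightarrow> ('a \<Rightarrow> real vec) \<Rightarrow> bool" where
  "affinely_compatible \<Omega> \<rho> \<tau> \<longleftrightarrow>
     (\<exists>a b. a \<noteq> 0 \<and> (\<forall>x\<in>\<Omega>. \<forall>y\<in>\<Omega>. \<rho> x y = a * (\<tau> x \<bullet> \<tau> y) + b))"

definition weighted_design ::
    "'a set \<Rightarrow> ('a \<Rightarrow> 'a \<Rightarrow> real) \<Rightarrow> (('a \<Rightarrow> real) \<Rightarrow> ('a \<Rightarrow> real) \<Rightarrow> real) \<Rightarrow>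
     nat \<Rightarrow> 'a set \<Rightarrow> ('a \<Rightarrow> real) \<Rightarrow> bool" where
  "weighted_design \<Omega> \<rho> ip t X w \<longleftrightarrow>
     finite X \<and> X \<subseteq> \<Omega> \<and> (\<forall>x\<in>X. w x > 0) \<and>
     (\<forall>f\<in>Pol_deg \<Omega> \<rho> t. ip (fun_on \<Omega> (\<lambda>_. 1)) f = (\<Sum>x\<in>X. w x * f x))"

definition probability_function :: "'a set \<Rightarrow> ('a \<Rightarrow> real) \<Rightarrow> bool" where
  "probability_function \<Omega> \<mu> \<longleftrightarrow> (\<forall>x\<in>\<Omega>. \<mu> x \<ge> 0) \<and> (\<Sum>x\<in>\<Omega>. \<mu> x) = 1"

section \<open>Multivariate polynomials\<close>

text \<open>
  A polynomial maps exponent vectors to coefficients; the variables are indexed from \<open>0\<close>,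
  like the coordinates of vectors.
\<close>

type_synonym real_mpoly = "(nat \<Rightarrow>\<^sub>0 nat) \<Rightarrow>\<^sub>0 real"

definition monom_degree :: "(nat \<Rightarrow>\<^sub>0 nat) \<Rightarrow> nat" where
  "monom_degree m = (\<Sum>i\<in>Poly_Mapping.keys m. Poly_Mapping.lookup m i)"

definition mpolys :: "nat \<Rightarrow> nat \<Rightarrow> real_mpoly set" where
  "mpolys n t = {f. \<forall>m\<in>Poly_Mapping.keys f.
     Poly_Mapping.keys m \<subseteq> {..<n} \<and> monom_degree m \<le> t}"

definition mpoly_eval :: "real_mpoly \<Rightarrow> real vec \<Rightarrow> real" where
  "mpoly_eval f v = (\<Sum>m\<in>Poly_Mapping.keys f.
     Poly_Mapping.lookup f m * (\<Prod>i\<in>Poly_Mapping.keys m. v $ i ^ Poly_Mapping.lookup m i))"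

end

theory Submission
  imports Defs
begin

text \<open>
  Affine compatibility puts every generator of \<open>Pol_deg \<Omega> \<rho> 1\<close> into the span of the constant
  function and the \<open>n\<close> coordinate functions of \<open>\<tau>\<close>. That span has dimension at most \<open>n + 1\<close>, which is
  the dimension of \<open>Pol_deg \<Omega> \<rho> 1\<close>, so the two spaces coincide. Hence the coordinates of \<open>\<tau>\<close> are
  polynomials of degree one on \<open>\<Omega>\<close>, and composing with \<open>\<tau>\<close> maps polynomials of degree at most \<open>t\<close>
  into \<open>Pol_deg \<Omega> \<rho> t\<close>, where the design identity applies.
\<close>

section \<open>Functions cut off outside the carrier, and some linear algebra\<close>

lemma fun_on_scale: "fun_on \<Omega> (\<lambda>x. c * f x) = fscale c (fun_on \<Omega> f)"
  by (auto simp: fun_on_def fscale_def)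

lemma fun_on_plus: "fun_on \<Omega> (\<lambda>x. f x + g x) = fun_on \<Omega> f + fun_on \<Omega> g"
  by (auto simp: fun_on_def)

lemma fun_on_sum: "fun_on \<Omega> (\<lambda>x. \<Sum>i\<in>I. f i x) = (\<Sum>i\<in>I. fun_on \<Omega> (f i))"
proof (induction I rule: infinite_finite_induct)
  case (insert i I)
  then show ?case by (simp add: fun_on_plus)
qed (auto simp: fun_on_def)

text \<open>An element of \<open>C\<close> outside \<open>V\<close> would extend a basis of
  \<open>V\<close> to an independent subset of \<open>span C\<close> with more than
  \<open>card C\<close> elements.\<close>

lemma (in vector_space) span_eq_of_dim_ge_card:
  assumes V: "subspace V" and C: "finite C" and VC: "V \<subseteq> span C" and dim: "card C \<le> dim V"
  shows "V = span C"
proof -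
  obtain B where B: "B \<subseteq> V" "independent B" "V \<subseteq> span B" "card B = dim V"
    using basis_exists by blast
  have spanB: "span B = V" using span_minimal[OF B(1) V] B(3) by blast
  have "finite B" using independent_span_bound[OF C B(2)] B(1) VC by blast
  have "C \<subseteq> V"
  proof (rule ccontr)
    assume "\<not> C \<subseteq> V"
    then obtain c where c: "c \<in> C" "c \<notin> span B" using spanB by blast
    then have "independent (insert c B)" using B(2) by (simp add: independent_insertI)
    moreover have "insert c B \<subseteq> span C" using c(1) B(1) VC span_base by blast
    ultimately have "card (insert c B) \<le> card C" using independent_span_bound[OF C] by blast
    moreover have "c \<notin> B" using c(2) span_base by blast
    ultimately show False using \<open>finite B\<close> B(4) dim by simp
  qed
  then show ?thesis using VC span_minimal[OF _ V] by blast
qed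

lemma poly_degree_le_1:
  fixes f :: "'b :: comm_semiring_0 poly"
  assumes "degree f \<le> 1"
  shows "poly f y = coeff f 0 + coeff f 1 * y"
proof -
  obtain a p where f: "f = pCons a p" by (cases f)
  with assms have "degree p = 0" by (auto split: if_splits)
  then obtain b where "p = [:b:]" by (rule degree_eq_zeroE)
  with f show ?thesis by (simp add: mult.commute)
qed

section \<open>The filtration by degree\<close>

lemma subspace_Pol_deg: "fspace.subspace (Pol_deg \<Omega> \<rho> r)"
\<comment> \<open>Only degree 0 is given as an explicit set; in the other two cases
  \<open>Pol_deg\<close> is a span.\<close>
proof (cases "(\<Omega>, \<rho>, r)" rule: Pol_deg.cases)
  case 1
  show ?thesis
    unfolding fspace.subspace_def
  proof (intro conjI ballI allI)
    have "0 = fun_on \<Omega> (\<lambda>_. 0)" by (auto simp: fun_on_def)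
    then show "0 \<in> Pol_deg \<Omega> \<rho> r" using 1 by auto
    fix f assume f: "f \<in> Pol_deg \<Omega> \<rho> r"
    then obtain c where c: "f = fun_on \<Omega> (\<lambda>_. c)" using 1 by auto
    show "fscale k f \<in> Pol_deg \<Omega> \<rho> r" for k
      using 1 by (auto simp: c fun_on_scale[symmetric])
    fix g assume "g \<in> Pol_deg \<Omega> \<rho> r"
    then obtain d where d: "g = fun_on \<Omega> (\<lambda>_. d)" using 1 by auto
    show "f + g \<in> Pol_deg \<Omega> \<rho> r"
      using 1 by (auto simp: c d fun_on_plus[symmetric])
  qed
qed auto

lemma const_in_Pol_deg_1:
  assumes "\<Omega> \<noteq> {}"
  shows "fun_on \<Omega> (\<lambda>_. c) \<in> Pol_deg \<Omega> \<rho> (Suc 0)"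
proof -
  \<comment> \<open>The point \<open>a\<close> only serves to write the constant as a generator,
    with a constant polynomial applied to \<open>\<rho> a\<close>.\<close>
  obtain a where "a \<in> \<Omega>" using assms by blast
  moreover have "fun_on \<Omega> (\<lambda>_. c) = fun_on \<Omega> (poly [:c:] \<circ> \<rho> a)" by (simp add: comp_def)
  ultimately show ?thesis
    by (auto intro!: fspace.span_base exI[of _ a] exI[of _ "[:c:]"])
qed

text \<open>The function representing a constant is cut off to 0 outside \<open>\<Omega>\<close>.
  Hence multiplying by it acts as scaling only on functions that vanish there as well.\<close>

lemma Pol_deg_vanishes_outside:
  assumes "g \<in> Pol_deg \<Omega> \<rho> r" and "x \<notin> \<Omega>"
  shows "g x = 0"
  using assms
proof (induction \<Omega> \<rho> r arbitrary: g rule: Pol_deg.induct)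
  case (1 \<Omega> \<rho>)
  then show ?case by (auto simp: fun_on_def)
next
  case (2 \<Omega> \<rho>)
  from 2(1) show ?case unfolding Pol_deg.simps
    by (induction rule: fspace.span_induct_alt) (use 2(2) in \<open>auto simp: fun_on_def fscale_def\<close>)
next
  case (3 \<Omega> \<rho> r)
  from 3(3) show ?case unfolding Pol_deg.simps(3)
    by (induction rule: fspace.span_induct_alt) (use 3 in \<open>auto simp: fscale_def\<close>)
qed

text \<open>In positive degree the product is a generator of the next space. Degree 0 is separate,
  because degree 1 is not defined through products: there \<open>g\<close> is a constant, and the
  product is a multiple of \<open>h\<close>.\<close>

lemma Pol_deg_times_Pol_deg_1:
  assumes g: "g \<in> Pol_deg \<Omega> \<rho> r" and h: "h \<in> Pol_deg \<Omega> \<rho> (Suc 0)"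
  shows "g * h \<in> Pol_deg \<Omega> \<rho> (Suc r)"
proof (cases r)
  case 0
  with g obtain c where "g = fun_on \<Omega> (\<lambda>_. c)" by auto
  then have "g * h = fscale c h" using Pol_deg_vanishes_outside[OF h]
    by (auto simp: fun_on_def fscale_def)
  with 0 h show ?thesis by (simp add: fspace.span_scale)
next
  case (Suc r')
  with g h show ?thesis by (auto intro!: fspace.span_base)
qed

text \<open>The constant 1 has degree at most one, so multiplying by it raises the degree index by
  one and leaves the function unchanged.\<close>

lemma Pol_deg_mono:
  assumes ne: "\<Omega> \<noteq> {}" and "r \<le> s"
  shows "Pol_deg \<Omega> \<rho> r \<subseteq> Pol_deg \<Omega> \<rho> s"
  using \<open>r \<le> s\<close>
proof (rule lift_Suc_mono_le[rotated])
  show "Pol_deg \<Omega> \<rho> k \<subseteq> Pol_deg \<Omega> \<rho> (Suc k)" for k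
  proof
    fix g assume g: "g \<in> Pol_deg \<Omega> \<rho> k"
    show "g \<in> Pol_deg \<Omega> \<rho> (Suc k)"
    proof -
      have "g * fun_on \<Omega> (\<lambda>_. 1) = g"
        using Pol_deg_vanishes_outside[OF g] by (auto simp: fun_on_def)
      with Pol_deg_times_Pol_deg_1[OF g const_in_Pol_deg_1[OF ne, of 1]] show ?thesis by metis
    qed
  qed
qed

text \<open>The factor \<open>g\<close> is the part of a monomial built so far; it is multiplied by
  the power of one further variable, one factor at a time.\<close>

lemma fun_on_mult_power_in_Pol_deg:
  assumes "fun_on \<Omega> g \<in> Pol_deg \<Omega> \<rho> r" and h: "fun_on \<Omega> h \<in> Pol_deg \<Omega> \<rho> (Suc 0)"
  shows "fun_on \<Omega> (\<lambda>x. g x * h x ^ k) \<in> Pol_deg \<Omega> \<rho> (r + k)"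
proof (induction k)
  case 0
  then show ?case using assms by simp
next
  case (Suc k)
  have "fun_on \<Omega> (\<lambda>x. g x * h x ^ Suc k) = fun_on \<Omega> (\<lambda>x. g x * h x ^ k) * fun_on \<Omega> h"
    by (auto simp: fun_on_def)
  then show ?case using Pol_deg_times_Pol_deg_1[OF Suc h] by (metis add_Suc_right)
qed

lemma fun_on_monomial_in_Pol_deg:
  assumes "finite S" and "\<And>i. i \<in> S \<Longrightarrow> fun_on \<Omega> (h i) \<in> Pol_deg \<Omega> \<rho> (Suc 0)"
  shows "fun_on \<Omega> (\<lambda>x. \<Prod>i\<in>S. h i x ^ e i) \<in> Pol_deg \<Omega> \<rho> (\<Sum>i\<in>S. e i)"
  using assms
proof (induction S rule: finite_induct)
  case empty
  then show ?case by auto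
next
  case (insert i S)
  then have "fun_on \<Omega> (\<lambda>x. (\<Prod>i\<in>S. h i x ^ e i) * h i x ^ e i)
      \<in> Pol_deg \<Omega> \<rho> ((\<Sum>i\<in>S. e i) + e i)"
    by (intro fun_on_mult_power_in_Pol_deg) auto
  with insert.hyps show ?case by (simp add: mult.commute add.commute)
qed

section \<open>Composition with \<open>\<tau>\<close>: coordinates, then polynomials\<close>

lemma coordinate_in_Pol_deg_1:
  assumes ne: "\<Omega> \<noteq> {}" and dim: "Pol_dim \<Omega> \<rho> = n"
    and \<tau>: "\<tau> \<in> \<Omega> \<rightarrow> carrier_vec n" and compat: "affinely_compatible \<Omega> \<rho> \<tau>" and "i < n"
  shows "fun_on \<Omega> (\<lambda>x. \<tau> x $ i) \<in> Pol_deg \<Omega> \<rho> (Suc 0)"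
proof -
  let ?V = "Pol_deg \<Omega> \<rho> (Suc 0)"
  let ?one = "fun_on \<Omega> (\<lambda>_. 1)"
  define C where "C = insert ?one ((\<lambda>i. fun_on \<Omega> (\<lambda>x. \<tau> x $ i)) ` {..<n})"
  have fin: "finite C" by (simp add: C_def)
  \<comment> \<open>The coordinate functions are not yet known to be distinct, so the cardinality is
    only bounded above.\<close>
  have "card C \<le> Suc (card ((\<lambda>i. fun_on \<Omega> (\<lambda>x. \<tau> x $ i)) ` {..<n}))"
    unfolding C_def by (rule card_insert_le_m1[of "Suc _", simplified]) simp_all
  also have "\<dots> \<le> Suc n" using card_image_le[of "{..<n}"] by fastforce
  finally have card: "card C \<le> Suc n" .
  obtain a b where ab: "\<And>x y. x \<in> \<Omega> \<Longrightarrow> y \<in> \<Omega> \<Longrightarrow> \<rho> x y = a * (\<tau> x \<bullet> \<tau> y) + b"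
    using compat unfolding affinely_compatible_def by blast
  have gen: "fun_on \<Omega> (poly f \<circ> \<rho> z) \<in> fspace.span C" if z: "z \<in> \<Omega>" and f: "degree f \<le> 1" for f z
  proof -
    \<comment> \<open>Substitute \<open>a * (\<tau> z \<bullet> \<tau> x) + b\<close> for
      \<open>\<rho> z x\<close> in the linear polynomial \<open>f\<close>. The factor
      \<open>1\<close> gives the constant term the shape that \<open>fun_on_scale\<close> turns into
      a multiple of an element of \<open>C\<close>.\<close>
    have "fun_on \<Omega> (poly f \<circ> \<rho> z) =
        fun_on \<Omega> (\<lambda>x. (coeff f 0 + coeff f 1 * b) * 1
          + (\<Sum>i<n. (coeff f 1 * a * (\<tau> z $ i)) * \<tau> x $ i))"
    proof
      fix x
      show "fun_on \<Omega> (poly f \<circ> \<rho> z) x =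
        fun_on \<Omega> (\<lambda>x. (coeff f 0 + coeff f 1 * b) * 1
          + (\<Sum>i<n. (coeff f 1 * a * (\<tau> z $ i)) * \<tau> x $ i)) x"
      proof (cases "x \<in> \<Omega>")
        case True
        then have "dim_vec (\<tau> x) = n" using \<tau> carrier_vecD by blast
        then have "\<tau> z \<bullet> \<tau> x = (\<Sum>i<n. \<tau> z $ i * \<tau> x $ i)"
          by (simp add: scalar_prod_def atLeast0LessThan)
        with True ab[OF z True] show ?thesis
          by (simp add: fun_on_def poly_degree_le_1[OF f] algebra_simps sum_distrib_left)
      qed (simp add: fun_on_def)
    qed
    also have "\<dots> \<in> fspace.span C"
      unfolding fun_on_plus fun_on_sum fun_on_scale
      by (intro fspace.span_add fspace.span_sum fspace.span_scale fspace.span_base)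
        (auto simp: C_def)
    finally show ?thesis .
  qed
  have sub: "?V \<subseteq> fspace.span C"
    unfolding Pol_deg.simps by (rule fspace.span_minimal) (use gen in auto)
  \<comment> \<open>With truncated subtraction, \<open>Pol_dim\<close> would be 0 for dimension 0 as
    well as 1. Excluding 0 makes the dimension exactly \<open>Suc n\<close>.\<close>
  have "fspace.dim ?V \<noteq> 0"
  proof
    assume "fspace.dim ?V = 0"
    moreover obtain B where B: "B \<subseteq> ?V" "fspace.independent B" "?V \<subseteq> fspace.span B"
        "card B = fspace.dim ?V"
      using fspace.basis_exists by blast
    \<comment> \<open>Infinite sets also have \<open>card\<close> 0, so finiteness is what makes
      \<open>B\<close> empty here.\<close>
    moreover have "finite B"
      using fspace.independent_span_bound[OF fin B(2)] B(1) sub by blast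
    ultimately have "?one = 0" using const_in_Pol_deg_1[OF ne, of 1 \<rho>] by auto
    with ne show False by (auto simp: fun_on_def fun_eq_iff split: if_splits)
  qed
  with dim card have "card C \<le> fspace.dim ?V" by (simp add: Pol_dim_def)
  from fspace.span_eq_of_dim_ge_card[OF subspace_Pol_deg fin sub this]
  have "?V = fspace.span C" .
  with \<open>i < n\<close> show ?thesis by (auto simp: C_def intro!: fspace.span_base)
qed

text \<open>The composite is a linear combination of monomials in the coordinate functions. Each
  lies in the space indexed by its own total degree, which monotonicity embeds in that of index
  \<open>t\<close>.\<close>

lemma mpoly_comp_in_Pol_deg:
  assumes ne: "\<Omega> \<noteq> {}" and f: "f \<in> mpolys n t"
    and coord: "\<And>i. i < n \<Longrightarrow> fun_on \<Omega> (\<lambda>x. \<tau> x $ i) \<in> Pol_deg \<Omega> \<rho> (Suc 0)"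
  shows "fun_on \<Omega> (mpoly_eval f \<circ> \<tau>) \<in> Pol_deg \<Omega> \<rho> t"
proof -
  have monom: "fun_on \<Omega> (\<lambda>x. \<Prod>i\<in>Poly_Mapping.keys m. \<tau> x $ i ^ Poly_Mapping.lookup m i)
      \<in> Pol_deg \<Omega> \<rho> t" if "m \<in> Poly_Mapping.keys f" for m
  proof -
    have "Poly_Mapping.keys m \<subseteq> {..<n}" and deg: "monom_degree m \<le> t"
      using f that by (auto simp: mpolys_def)
    then have "fun_on \<Omega> (\<lambda>x. \<Prod>i\<in>Poly_Mapping.keys m. \<tau> x $ i ^ Poly_Mapping.lookup m i)
        \<in> Pol_deg \<Omega> \<rho> (monom_degree m)"
      unfolding monom_degree_def
      by (intro fun_on_monomial_in_Pol_deg) (auto intro!: coord simp del: Pol_deg.simps)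
    with Pol_deg_mono[OF ne deg] show ?thesis by blast
  qed
  have "fun_on \<Omega> (mpoly_eval f \<circ> \<tau>) = (\<Sum>m\<in>Poly_Mapping.keys f. fscale (Poly_Mapping.lookup f m)
      (fun_on \<Omega> (\<lambda>x. \<Prod>i\<in>Poly_Mapping.keys m. \<tau> x $ i ^ Poly_Mapping.lookup m i)))"
    by (simp add: mpoly_eval_def comp_def fun_on_sum fun_on_scale)
  also have "\<dots> \<in> Pol_deg \<Omega> \<rho> t"
    by (intro fspace.subspace_sum fspace.subspace_scale subspace_Pol_deg monom)
  finally show ?thesis .
qed

section \<open>The design identity for polynomials in the coordinates\<close>

theorem theorem2p14:
  fixes \<Omega> :: "'a set"
    and \<rho> :: "'a \<Rightarrow> 'a \<Rightarrow> real"
    and ip :: "('a \<Rightarrow> real) \<Rightarrow> ('a \<Rightarrow> real) \<Rightarrow> real"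
    and n t :: nat
    and X :: "'a set"
    and w :: "'a \<Rightarrow> real"
    and \<tau> :: "'a \<Rightarrow> real vec"
  assumes "polynomial_space \<Omega> \<rho> ip"
    and "euclidean \<Omega> \<rho>"
    and "Pol_dim \<Omega> \<rho> = n"
    and "weighted_design \<Omega> \<rho> ip t X w"
    and "\<tau> \<in> \<Omega> \<rightarrow> carrier_vec n"
    and "inj_on \<tau> \<Omega>"
    and "affinely_compatible \<Omega> \<rho> \<tau>"
  shows "(\<forall>f\<in>mpolys n t.
            ip (fun_on \<Omega> (\<lambda>_. 1)) (fun_on \<Omega> (mpoly_eval f \<circ> \<tau>)) =
              (\<Sum>x\<in>X. w x * mpoly_eval f (\<tau> x))) \<and>
         (\<forall>\<mu>. finite \<Omega> \<and> probability_function \<Omega> \<mu> \<and>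
              (\<forall>g\<in>Pol \<Omega> \<rho>. \<forall>h\<in>Pol \<Omega> \<rho>. ip g h = (\<Sum>x\<in>\<Omega>. g x * h x * \<mu> x)) \<longrightarrow>
            (\<forall>f\<in>mpolys n t.
               (\<Sum>x\<in>\<Omega>. mpoly_eval f (\<tau> x) * \<mu> x) = (\<Sum>x\<in>X. w x * mpoly_eval f (\<tau> x)) \<and>
               (\<Sum>y\<in>\<tau> ` \<Omega>. mpoly_eval f y * \<mu> (inv_into \<Omega> \<tau> y)) =
                 (\<Sum>y\<in>\<tau> ` X. w (inv_into \<Omega> \<tau> y) * mpoly_eval f y)))"
proof -
  interpret polynomial_space \<Omega> \<rho> ip by fact
  let ?one = "fun_on \<Omega> (\<lambda>_. 1)"
  have X: "X \<subseteq> \<Omega>"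
    and design: "\<And>g. g \<in> Pol_deg \<Omega> \<rho> t \<Longrightarrow> ip ?one g = (\<Sum>x\<in>X. w x * g x)"
    using \<open>weighted_design \<Omega> \<rho> ip t X w\<close> by (auto simp: weighted_design_def)
  have mem: "fun_on \<Omega> (mpoly_eval f \<circ> \<tau>) \<in> Pol_deg \<Omega> \<rho> t" if "f \<in> mpolys n t" for f
    using nonempty that coordinate_in_Pol_deg_1[OF nonempty assms(3,5,7)]
    by (rule mpoly_comp_in_Pol_deg)
  have main: "ip ?one (fun_on \<Omega> (mpoly_eval f \<circ> \<tau>)) = (\<Sum>x\<in>X. w x * mpoly_eval f (\<tau> x))"
    if "f \<in> mpolys n t" for f
    \<comment> \<open>The cut-off disappears from the sum because \<open>X\<close> lies in
      \<open>\<Omega>\<close>.\<close>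
    unfolding design[OF mem[OF that]]
    using X by (intro sum.cong) (auto simp: fun_on_def)
  have fin: "(\<Sum>x\<in>\<Omega>. mpoly_eval f (\<tau> x) * \<mu> x) = (\<Sum>x\<in>X. w x * mpoly_eval f (\<tau> x))"
    if ip: "\<forall>g\<in>Pol \<Omega> \<rho>. \<forall>h\<in>Pol \<Omega> \<rho>. ip g h = (\<Sum>x\<in>\<Omega>. g x * h x * \<mu> x)"
      and f: "f \<in> mpolys n t" for \<mu> f
  proof -
    have "?one \<in> Pol \<Omega> \<rho>" "fun_on \<Omega> (mpoly_eval f \<circ> \<tau>) \<in> Pol \<Omega> \<rho>"
      unfolding Pol_def using const_in_Pol_deg_1[OF nonempty] mem[OF f] by blast+
    with ip have "ip ?one (fun_on \<Omega> (mpoly_eval f \<circ> \<tau>)) =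
        (\<Sum>x\<in>\<Omega>. ?one x * fun_on \<Omega> (mpoly_eval f \<circ> \<tau>) x * \<mu> x)" by blast
    also have "\<dots> = (\<Sum>x\<in>\<Omega>. mpoly_eval f (\<tau> x) * \<mu> x)"
      by (intro sum.cong) (auto simp: fun_on_def)
    finally show ?thesis using main[OF f] by simp
  qed
  \<comment> \<open>\<open>F\<close> takes a point and its preimage separately, so that one identity
    serves both the sum weighted by \<open>\<mu>\<close> and the one weighted by \<open>w\<close>.
    In both, the inverse is taken on all of \<open>\<Omega>\<close>.\<close>
  have reindex: "(\<Sum>y\<in>\<tau> ` Y. F y (inv_into \<Omega> \<tau> y)) = (\<Sum>x\<in>Y. F (\<tau> x) x)"
    if "Y \<subseteq> \<Omega>" for Y and F :: "real vec \<Rightarrow> 'a \<Rightarrow> real"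
  proof -
    have "inj_on \<tau> Y" using \<open>inj_on \<tau> \<Omega>\<close> that by (rule inj_on_subset)
    then show ?thesis
      using that by (auto simp: sum.reindex inv_into_f_f[OF \<open>inj_on \<tau> \<Omega>\<close>] intro!: sum.cong)
  qed
  show ?thesis
    \<comment> \<open>The wildcards keep the polynomial and \<open>\<mu>\<close> schematic, so the
      instances rewrite below the quantifiers.\<close>
    using main fin reindex[OF order_refl, of "\<lambda>y x. mpoly_eval _ y * _ x"]
      reindex[OF X, of "\<lambda>y x. w x * mpoly_eval _ y"] by simp
qed

end
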